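(* Let $n,c$ be positive integers and $a\in\{1,\dots,c\}$. Then $$\left|\Pi_n^{eq}\wr C_c(1^a2^a2^a)\right|=B(n)(c-1)^n+B(n)\,n\,(c-1)^{n-1}+\sum_{i=2}^n\sum_{\ell=1}^i\sum_{j=0}^{n-i}\binom{n}{i}\binom{n-i}{j}(i-\ell+1)^jB(n-i-j)(c-1)^{n-i}$$ $$+\sum_{i=2}^n\sum_{\ell=1}^{i-2}\sum_{j=0}^{n-i}\binom{n}{i}\binom{n-i}{j}(i-\ell-1)(i-\ell)^jB(n-i-j)(c-1)^{n-i}.$$
   Context: $\Pi_n\wr C_c$ is the set of colored set partitions of $[n]$: a set partition of $[n]$ together with a color in $\{1,\dots,c\}$ for each element. A colored partition eq-contains $1^a2^a2^a$ iff there are elements $x<y<z$, all colored $a$, with $y$ and $z$ in the same block and $x$ in a different block; $\Pi_n^{eq}\wr C_c(1^a2^a2^a)$ is the set of those that do not. $B(m)$ is the $m$-th Bell number; empty sums are $0$ and $0^0=1$. *)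

theory Defs
  imports "HOL-Library.Disjoint_Sets" "HOL-Library.FuncSet"
begin

definition bell :: "nat \<Rightarrow> nat" where
  "bell m = card {P. partition_on {1..m} P}"

text \<open>A coloured set partition is a pair of a partition of \<open>{1..n}\<close> and a colouring;
  the colouring is extensional, so that distinct pairs are distinct coloured partitions.\<close>

definition colored_partitions :: "nat \<Rightarrow> nat \<Rightarrow> (nat set set \<times> (nat \<Rightarrow> nat)) set" where
  "colored_partitions n c = {P. partition_on {1..n} P} \<times> ({1..n} \<rightarrow>\<^sub>E {1..c})"

definition eq_contains_122 :: "nat \<Rightarrow> nat set set \<times> (nat \<Rightarrow> nat) \<Rightarrow> bool" where
  "eq_contains_122 a \<pi> \<longleftrightarrow>
    (\<exists>x y z. x < y \<and> y < z \<and> snd \<pi> x = a \<and> snd \<pi> y = a \<and> snd \<pi> z = a \<and>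
      (\<exists>X \<in> fst \<pi>. \<exists>Y \<in> fst \<pi>. X \<noteq> Y \<and> x \<in> X \<and> y \<in> Y \<and> z \<in> Y))"

definition eq_avoiders_122 :: "nat \<Rightarrow> nat \<Rightarrow> nat \<Rightarrow> (nat set set \<times> (nat \<Rightarrow> nat)) set" where
  "eq_avoiders_122 n c a = {\<pi> \<in> colored_partitions n c. \<not> eq_contains_122 a \<pi>}"

end

theory Submission
  imports Defs
begin

text \<open>Sort the coloured partitions by the set \<open>A\<close> of elements coloured \<open>a\<close>: only the restriction
  to \<open>A\<close> matters for avoidance. An avoiding partition of \<open>A\<close> is either the discrete one or consists
  of one block \<open>{x \<in> A. x \<le> y} \<union> {b}\<close> with \<open>y < b\<close> in \<open>A\<close> and singletons. The number of extensions
  of a partition with \<open>k\<close> blocks by \<open>t\<close> new points satisfies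
  \<open>E (t + 1) k = k * E t k + E t (k + 1)\<close>, since a new point joins a block or opens a new one;
  this recursion gives \<open>E t k = (\<Sum>j. (t choose j) * k ^ j * E (t - j) 0)\<close>,
  and \<open>E m 0\<close> is the Bell number.\<close>

subsection \<open>Extending a partition to a larger set\<close>

definition restr :: "'a set \<Rightarrow> 'a set set \<Rightarrow> 'a set set" where
  "restr A P = (\<inter>) A ` P - {{}}"

lemma partition_on_restr:
  assumes "partition_on S P" "A \<subseteq> S"
  shows "partition_on A (restr A P)"
  using partition_on_restrict[OF assms(1), of A] assms(2)
  by (simp add: restr_def Int_absorb2)

lemma restr_restr:
  assumes "A \<subseteq> B"
  shows "restr A (restr B P) = restr A P"
proof -
  have *: "A \<inter> (B \<inter> X) = A \<inter> X" for X
    using assms by blast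
  have "restr A (restr B P) = (\<inter>) A ` (\<inter>) B ` P - {{}}"
    unfolding restr_def by blast
  also have "\<dots> = restr A P"
    by (simp add: image_image * restr_def)
  finally show ?thesis .
qed

lemma restr_self:
  assumes "partition_on A P"
  shows "restr A P = P"
proof -
  have "A \<inter> X = X" if "X \<in> P" for X
    using that assms by (auto simp: partition_on_def)
  then have "(\<inter>) A ` P = P"
    by (simp cong: image_cong)
  then show ?thesis
    using assms by (auto simp: restr_def partition_on_def)
qed

definition exts :: "'a set \<Rightarrow> 'a set \<Rightarrow> 'a set set \<Rightarrow> 'a set set set" where
  "exts S A Q = {P. partition_on S P \<and> restr A P = Q}"

lemma finite_exts: "finite S \<Longrightarrow> finite (exts S A Q)"
  unfolding exts_def by (rule finite_subset[OF _ finitely_many_partition_on]) auto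

text \<open>With \<open>X = {}\<close> the new point becomes a block of its own.\<close>

definition add_to_block :: "'a \<Rightarrow> 'a set set \<Rightarrow> 'a set \<Rightarrow> 'a set set" where
  "add_to_block x Q X = insert (insert x X) (Q - {X})"

lemma partition_on_add_to_block:
  assumes "partition_on A Q" "x \<notin> A" "X \<in> insert {} Q"
  shows "partition_on (insert x A) (add_to_block x Q X)"
    and "restr A (add_to_block x Q X) = Q"
proof -
  have Q: "\<Union>Q = A" "{} \<notin> Q" "\<And>X Y. X \<in> Q \<Longrightarrow> Y \<in> Q \<Longrightarrow> X \<noteq> Y \<Longrightarrow> X \<inter> Y = {}"
    using assms(1) by (auto simp: partition_on_def disjoint_def)
  show "partition_on (insert x A) (add_to_block x Q X)"
  proof (rule partition_onI)
    show "\<Union>(add_to_block x Q X) = insert x A"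
      using Q(1) assms(3) by (auto simp: add_to_block_def)
    show "{} \<notin> add_to_block x Q X"
      using Q(2) by (auto simp: add_to_block_def)
    have *: "insert x X \<inter> q = {}" if "q \<in> Q - {X}" for q
    proof -
      have "x \<notin> q" using that Q(1) assms(2) by blast
      moreover have "X \<inter> q = {}" using that Q(3)[of X q] assms(3) by auto
      ultimately show ?thesis by blast
    qed
    show "disjnt p q" if "p \<in> add_to_block x Q X" "q \<in> add_to_block x Q X" "p \<noteq> q" for p q
      using that Q(3)[of p q] *[of p] *[of q] unfolding add_to_block_def disjnt_def
      by blast
  qed
  have "A \<inter> Y = Y" if "Y \<in> Q" for Y
    using that Q(1) by blast
  then have "(\<inter>) A ` (Q - {X}) = Q - {X}"
    by (force simp: image_iff)
  moreover have "A \<inter> insert x X = X"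
    using assms(2,3) Q(1) by blast
  ultimately have "(\<inter>) A ` add_to_block x Q X = insert X (Q - {X})"
    by (simp add: add_to_block_def)
  then show "restr A (add_to_block x Q X) = Q"
    using assms(3) Q(2) by (auto simp: restr_def)
qed

text \<open>Let \<open>Z\<close> be the block of \<open>x\<close>. Its trace
  \<open>A \<inter> Z\<close> is the block that \<open>x\<close> was added to; the trace is empty
  exactly if \<open>Z = {x}\<close>, and then \<open>restr\<close> discards it.\<close>

lemma partition_on_insert_is_add_to_block:
  assumes "partition_on (insert x A) R" "x \<notin> A"
  shows "R \<in> add_to_block x (restr A R) ` insert {} (restr A R)"
proof -
  have R: "\<Union>R = insert x A" "{} \<notin> R" "\<And>X Y. X \<in> R \<Longrightarrow> Y \<in> R \<Longrightarrow> X \<noteq> Y \<Longrightarrow> X \<inter> Y = {}"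
    using assms(1) by (auto simp: partition_on_def disjoint_def)
  then obtain Z where Z: "Z \<in> R" "x \<in> Z" by blast
  let ?X = "A \<inter> Z"
  have ZX: "insert x ?X = Z" using Z R(1) by blast
  have "A \<inter> Y = Y" if "Y \<in> R - {Z}" for Y
  proof -
    have "x \<notin> Y" using that R(3)[of Y Z] Z by blast
    moreover have "Y \<subseteq> insert x A" using that R(1) by blast
    ultimately show ?thesis by blast
  qed
  then have "(\<inter>) A ` (R - {Z}) = R - {Z}"
    by (force simp: image_iff)
  then have "(\<inter>) A ` R = insert ?X (R - {Z})"
    using Z(1) by (metis image_insert insert_Diff)
  then have restr: "restr A R = insert ?X (R - {Z}) - {{}}"
    by (simp add: restr_def)
  \<comment> \<open>Removing the trace from \<open>restr A R\<close> must not delete an untouched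
    block: such a block would be disjoint from \<open>Z\<close>, hence empty.\<close>
  have "?X \<notin> R - {Z}"
  proof
    assume X: "?X \<in> R - {Z}"
    then have "?X \<inter> Z = {}" using R(3)[of ?X Z] Z(1) by blast
    then have "?X = {}" by blast
    then show False using X R(2) by simp
  qed
  then have "restr A R - {?X} = R - {Z}"
    using R(2) unfolding restr by auto
  then have "R = add_to_block x (restr A R) ?X"
    using Z(1) ZX by (auto simp: add_to_block_def)
  moreover have "?X \<in> insert {} (restr A R)"
    unfolding restr by auto
  ultimately show ?thesis by blast
qed

text \<open>The enlarged block is the only member of the result that contains \<open>x\<close>, so
  removing \<open>x\<close> from it recovers \<open>X\<close>.\<close>

lemma inj_on_add_to_block:
  assumes "x \<notin> \<Union>Q"
  shows "inj_on (add_to_block x Q) (insert {} Q)"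
proof (rule inj_onI)
  fix X Y assume XY: "X \<in> insert {} Q" "Y \<in> insert {} Q" "add_to_block x Q X = add_to_block x Q Y"
  then have "insert x X \<in> insert (insert x Y) (Q - {Y})"
    unfolding add_to_block_def by blast
  then have "insert x X = insert x Y" using assms by auto
  moreover have "x \<notin> X" "x \<notin> Y" using XY(1,2) assms by auto
  ultimately show "X = Y" by (metis insert_ident)
qed

lemma card_add_to_block:
  assumes "finite Q" "x \<notin> \<Union>Q" "{} \<notin> Q" "X \<in> insert {} Q"
  shows "card (add_to_block x Q X) = (if X = {} then Suc (card Q) else card Q)"
proof -
  have "insert x X \<notin> Q - {X}" using assms(2) by auto
  then have "card (add_to_block x Q X) = Suc (card (Q - {X}))"
    using assms(1) by (simp add: add_to_block_def)
  then show ?thesis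
    using assms by (auto simp: card_Suc_Diff1 simp del: card_Diff_insert)
qed

text \<open>The extensions of \<open>Q\<close> are sorted by where they put one further point
  \<open>x\<close>; counting the classes yields the recursion of \<open>ext_num\<close>.\<close>

lemma exts_eq_UN:
  assumes "partition_on A Q" "x \<in> S" "x \<notin> A" "A \<subseteq> S"
  shows "exts S A Q = (\<Union>X\<in>insert {} Q. exts S (insert x A) (add_to_block x Q X))"
proof (intro equalityI subsetI)
  fix P assume "P \<in> exts S A Q"
  then have P: "partition_on S P" "restr A P = Q" by (auto simp: exts_def)
  let ?R = "restr (insert x A) P"
  have "partition_on (insert x A) ?R"
    using P(1) assms by (intro partition_on_restr[of S]) auto
  moreover have "restr A ?R = Q"
    using P(2) by (simp add: restr_restr subset_insertI)
  ultimately have "?R \<in> add_to_block x Q ` insert {} Q"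
    using partition_on_insert_is_add_to_block[of x A ?R] assms(3) by simp
  then show "P \<in> (\<Union>X\<in>insert {} Q. exts S (insert x A) (add_to_block x Q X))"
    using P(1) by (auto simp: exts_def)
next
  fix P assume "P \<in> (\<Union>X\<in>insert {} Q. exts S (insert x A) (add_to_block x Q X))"
  then obtain X where X: "X \<in> insert {} Q" "partition_on S P"
      "restr (insert x A) P = add_to_block x Q X"
    unfolding exts_def by blast
  then have "restr A P = Q"
    using partition_on_add_to_block(2)[OF assms(1,3) X(1)] restr_restr[of A "insert x A" P]
    by (simp add: subset_insertI)
  then show "P \<in> exts S A Q" using X by (simp add: exts_def)
qed

text \<open>These are the r-Bell numbers with r = \<open>k\<close>: they count the partitions of
  \<open>t + k\<close> points in which \<open>k\<close> given points lie in different
  blocks.\<close>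

fun ext_num :: "nat \<Rightarrow> nat \<Rightarrow> nat" where
  "ext_num 0 k = 1"
| "ext_num (Suc t) k = k * ext_num t k + ext_num t (Suc k)"

text \<open>\<open>S\<close> stays fixed while \<open>A\<close> grows by one point per step. Of the
  choices for that point, \<open>card Q\<close> keep the number of blocks and one raises it, so only
  the number of blocks of \<open>Q\<close> matters.\<close>

lemma card_exts:
  assumes "finite S" "A \<subseteq> S" "partition_on A Q"
  shows "card (exts S A Q) = ext_num (card (S - A)) (card Q)"
  using assms(2,3)
proof (induction "card (S - A)" arbitrary: A Q)
  case 0
  then have "S = A" using assms(1) by auto
  then have "exts S A Q = {Q}"
    using 0 restr_self by (auto simp: exts_def)
  then show ?case using 0(1) by simp
next
  case (Suc t)
  then obtain x where x: "x \<in> S" "x \<notin> A"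
    by (metis DiffE card.empty equals0I nat.distinct(1))
  have t: "t = card (S - insert x A)"
    using Suc(2) x by (metis Diff_insert DiffI card_Diff_singleton diff_Suc_1)
  have finQ: "finite Q"
    using finite_elements[OF _ Suc(4)] finite_subset[OF Suc(3) assms(1)] by blast
  have Q: "x \<notin> \<Union>Q" "{} \<notin> Q"
    using Suc(4) x by (auto simp: partition_on_def)
  have "card (exts S A Q) = (\<Sum>X\<in>insert {} Q. card (exts S (insert x A) (add_to_block x Q X)))"
    unfolding exts_eq_UN[OF Suc(4) x Suc(3)]
  proof (rule card_UN_disjoint)
    show "\<forall>X\<in>insert {} Q. \<forall>Y\<in>insert {} Q. X \<noteq> Y \<longrightarrow>
      exts S (insert x A) (add_to_block x Q X) \<inter> exts S (insert x A) (add_to_block x Q Y) = {}"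
      using inj_on_add_to_block[OF Q(1)] unfolding inj_on_def exts_def by blast
  qed (use finQ assms(1) finite_exts in auto)
  also have "\<dots> = (\<Sum>X\<in>insert {} Q. ext_num t (card (add_to_block x Q X)))"
  proof (rule sum.cong)
    fix X assume "X \<in> insert {} Q"
    then have "partition_on (insert x A) (add_to_block x Q X)"
      by (rule partition_on_add_to_block(1)[OF Suc(4) x(2)])
    then show "card (exts S (insert x A) (add_to_block x Q X)) = ext_num t (card (add_to_block x Q X))"
      using Suc(1)[OF t, of "add_to_block x Q X"] x(1) Suc(3) unfolding t by blast
  qed simp
  also have "\<dots> = (\<Sum>X\<in>insert {} Q. ext_num t (if X = {} then Suc (card Q) else card Q))"
    using card_add_to_block[OF finQ Q] by (intro sum.cong) auto
  also have "\<dots> = ext_num t (Suc (card Q)) + (\<Sum>X\<in>Q. ext_num t (card Q))"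
  proof -
    have "(\<Sum>X\<in>Q. ext_num t (if X = {} then Suc (card Q) else card Q)) = (\<Sum>X\<in>Q. ext_num t (card Q))"
      using Q(2) by (intro sum.cong) auto
    then show ?thesis using finQ Q(2) by simp
  qed
  finally show ?case by (simp flip: Suc(2))
qed

section \<open>Extension numbers as sums of Bell numbers\<close>

lemma bell_eq_ext_num: "bell m = ext_num m 0"
proof -
  have "{P. partition_on {1..m} P} = exts {1..m} {} {}"
    by (auto simp: exts_def restr_def)
  then show ?thesis
    using card_exts[of "{1..m}" "{}" "{}"] by (simp add: bell_def partition_on_empty)
qed

text \<open>Mark \<open>k\<close> of the \<open>k + m\<close> blocks. If exactly \<open>j\<close>
  new points join marked blocks, there are \<open>(t choose j) * k ^ j\<close> ways to place them,
  and the other points extend the \<open>m\<close> unmarked blocks. The induction needs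
  \<open>m\<close> arbitrary because the recursion raises it.\<close>

lemma ext_num_add:
  "ext_num t (k + m) = (\<Sum>j\<le>t. (t choose j) * k ^ j * ext_num (t - j) m)"
proof (induction t arbitrary: m)
  case (Suc t)
  let ?f = "\<lambda>j. k ^ j * ext_num (Suc t - j) m"
  have "ext_num (Suc t) (k + m) = k * ext_num t (k + m) + (m * ext_num t (k + m) + ext_num t (k + Suc m))"
    by (simp add: algebra_simps)
  also have "m * ext_num t (k + m) + ext_num t (k + Suc m)
      = (\<Sum>j\<le>t. (t choose j) * k ^ j * (m * ext_num (t - j) m + ext_num (t - j) (Suc m)))"
    unfolding Suc.IH by (simp add: sum_distrib_left sum.distrib algebra_simps)
  also have "\<dots> = (\<Sum>j\<le>t. (t choose j) * ?f j)"
    by (intro sum.cong) (auto simp: Suc_diff_le)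
  \<comment> \<open>The added summand vanishes since \<open>t choose Suc t\<close> is 0; splitting
    off \<open>j = 0\<close> next prepares for Pascal's rule.\<close>
  also have "\<dots> = (\<Sum>j\<le>Suc t. (t choose j) * ?f j)"
    by simp
  also have "\<dots> = ?f 0 + (\<Sum>j\<le>t. (t choose Suc j) * ?f (Suc j))"
    by (subst sum.atMost_Suc_shift) simp
  also have "k * ext_num t (k + m) = (\<Sum>j\<le>t. (t choose j) * ?f (Suc j))"
    unfolding Suc.IH by (simp add: sum_distrib_left algebra_simps)
  also have "\<dots> + (?f 0 + (\<Sum>j\<le>t. (t choose Suc j) * ?f (Suc j)))
      = ?f 0 + (\<Sum>j\<le>t. (Suc t choose Suc j) * ?f (Suc j))"
    by (simp add: sum.distrib algebra_simps del: ext_num.simps)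
  also have "\<dots> = (\<Sum>j\<le>Suc t. (Suc t choose j) * ?f j)"
    by (simp add: sum.atMost_Suc_shift del: sum.atMost_Suc binomial_Suc_Suc ext_num.simps)
  finally show ?case by (simp add: mult.assoc)
qed simp

lemma ext_num_eq_sum_bell:
  "ext_num t k = (\<Sum>j = 0..t. (t choose j) * k ^ j * bell (t - j))"
  using ext_num_add[of t k 0] by (simp add: bell_eq_ext_num atLeast0AtMost)

subsection \<open>Avoiding partitions of a single-coloured set\<close>

text \<open>Concluding \<open>x \<in> Y\<close>, instead of naming a second block that holds
  \<open>x\<close>, makes the condition depend only on the traces of the blocks on \<open>A\<close>.
  This makes it compatible with \<open>restr\<close>.\<close>

definition avoids_on :: "'a::linorder set \<Rightarrow> 'a set set \<Rightarrow> bool" where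
  "avoids_on A P \<longleftrightarrow>
    (\<forall>x\<in>A. \<forall>y\<in>A. \<forall>z\<in>A. \<forall>Y\<in>P. x < y \<longrightarrow> y < z \<longrightarrow> y \<in> Y \<longrightarrow> z \<in> Y \<longrightarrow> x \<in> Y)"

lemma avoids_onD:
  "avoids_on A P \<Longrightarrow> Y \<in> P \<Longrightarrow> x < y \<Longrightarrow> y < z \<Longrightarrow> y \<in> Y \<Longrightarrow> z \<in> Y \<Longrightarrow>
    x \<in> A \<Longrightarrow> y \<in> A \<Longrightarrow> z \<in> A \<Longrightarrow> x \<in> Y"
  unfolding avoids_on_def by blast

lemma avoids_on_restr: "avoids_on A (restr A P) \<longleftrightarrow> avoids_on A P"
proof
  assume L: "avoids_on A (restr A P)"
  show "avoids_on A P"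
    unfolding avoids_on_def
  proof (intro ballI impI)
    fix x y z Y assume h: "x \<in> A" "y \<in> A" "z \<in> A" "Y \<in> P" "x < y" "y < z" "y \<in> Y" "z \<in> Y"
    then have "A \<inter> Y \<in> restr A P" by (auto simp: restr_def)
    then show "x \<in> Y" using avoids_onD[OF L, of "A \<inter> Y" x y z] h by auto
  qed
next
  assume R: "avoids_on A P"
  show "avoids_on A (restr A P)"
    unfolding avoids_on_def
  proof (intro ballI impI)
    fix x y z Y assume h: "x \<in> A" "y \<in> A" "z \<in> A" "Y \<in> restr A P" "x < y" "y < z" "y \<in> Y" "z \<in> Y"
    then obtain Z where Z: "Z \<in> P" "Y = A \<inter> Z" by (auto simp: restr_def)
    then show "x \<in> Y" using avoids_onD[OF R Z(1), of x y z] h by auto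
  qed
qed

section \<open>Shape and number of the avoiding partitions\<close>

definition one_block :: "'a set \<Rightarrow> 'a set \<Rightarrow> 'a set set" where
  "one_block A B = insert B ((\<lambda>x. {x}) ` (A - B))"

definition pair_block :: "'a::linorder set \<Rightarrow> 'a \<times> 'a \<Rightarrow> 'a set" where
  "pair_block A = (\<lambda>(y, b). insert b {x\<in>A. x \<le> y})"

definition less_pairs :: "'a::linorder set \<Rightarrow> ('a \<times> 'a) set" where
  "less_pairs A = (SIGMA y:A. {b\<in>A. y < b})"

lemma partition_on_one_block:
  "B \<subseteq> A \<Longrightarrow> B \<noteq> {} \<Longrightarrow> partition_on A (one_block A B)"
  by (auto simp: one_block_def partition_on_def disjoint_def)

text \<open>In an avoiding partition at most one block has several elements. If \<open>b\<close> is its largest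
  and \<open>y\<close> its second largest element, then everything below \<open>y\<close> lies in that block.\<close>

lemma avoiding_partitions_eq:
  fixes A :: "'a::linorder set"
  assumes "finite A"
  shows "{Q. partition_on A Q \<and> avoids_on A Q} =
    insert ((\<lambda>x. {x}) ` A) ((\<lambda>p. one_block A (pair_block A p)) ` less_pairs A)"
    (is "?L = ?R")
proof (intro equalityI subsetI)
  fix Q assume "Q \<in> ?L"
  then have part: "partition_on A Q" and av: "avoids_on A Q" by auto
  have Q: "\<Union>Q = A" "{} \<notin> Q" "\<And>X Y x. X \<in> Q \<Longrightarrow> Y \<in> Q \<Longrightarrow> x \<in> X \<Longrightarrow> x \<in> Y \<Longrightarrow> X = Y"
    using part by (auto simp: partition_on_def disjoint_def)
  show "Q \<in> ?R"
  proof (cases "\<exists>B\<in>Q. \<exists>u\<in>B. \<exists>v\<in>B. u < v")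
    case False
    have single: "C = {x}" if "C \<in> Q" "x \<in> C" for C x
      using that False by (metis empty_iff insertE insertI1 linorder_neqE subsetI subset_antisym)
    have "Q = (\<lambda>x. {x}) ` A"
    proof (intro equalityI subsetI)
      fix C assume C: "C \<in> Q"
      then obtain x where "x \<in> C" using Q(2) by fastforce
      then show "C \<in> (\<lambda>x. {x}) ` A" using single[OF C] C Q(1) by blast
    next
      fix C assume "C \<in> (\<lambda>x. {x}) ` A"
      then obtain x where x: "C = {x}" "x \<in> A" by blast
      then obtain D where "D \<in> Q" "x \<in> D" using Q(1) by blast
      then show "C \<in> Q" using single x by blast
    qed
    then show ?thesis by blast
  next
    case True
    then obtain B u v where B: "B \<in> Q" "u \<in> B" "v \<in> B" "u < v" by blast
    have BA: "B \<subseteq> A" using B Q by blast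
    then have finB: "finite B" using assms finite_subset by blast
    define b where "b = Max B"
    define y where "y = Max (B - {b})"
    have b: "b \<in> B" "\<And>x. x \<in> B \<Longrightarrow> x \<le> b"
      unfolding b_def using finB B(2) by (blast intro: Max_in, simp)
    have "u \<in> B - {b}" using b(2)[OF B(3)] B by auto
    then have y: "y \<in> B - {b}" "\<And>x. x \<in> B - {b} \<Longrightarrow> x \<le> y"
      using finB unfolding y_def by (metis Max_in empty_iff finite_Diff, metis Max_ge finite_Diff)
    have yb: "y < b" using y(1) b(2) by force
    have Beq: "B = pair_block A (y, b)"
    proof (intro equalityI subsetI)
      fix x assume "x \<in> B"
      then show "x \<in> pair_block A (y, b)" using y(2)[of x] BA by (auto simp: pair_block_def)
    next
      fix x assume "x \<in> pair_block A (y, b)"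
      then show "x \<in> B" using avoids_onD[OF av B(1), of x y b] y(1) b(1) yb BA
        by (auto simp: pair_block_def order.order_iff_strict)
    qed
    \<comment> \<open>Compare \<open>p < q\<close> in \<open>C\<close> with \<open>y < b\<close> in
      \<open>B\<close>. If \<open>y < p\<close>, avoidance pulls \<open>y\<close> into
      \<open>C\<close>; if \<open>p < y\<close>, it pulls \<open>p\<close> into \<open>B\<close>.
      Both contradict disjointness.\<close>
    have no_pair: False if C: "C \<in> Q" "C \<noteq> B" "p \<in> C" "q \<in> C" "p < q" for C p q
    proof -
      have "p \<in> A" "q \<in> A" "p \<notin> B" "y \<in> A" "b \<in> A" "y \<notin> C"
        using C Q B(1) y(1) b(1) BA by blast+
      moreover have "p \<noteq> y" using \<open>p \<notin> B\<close> y(1) by blast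
      ultimately show False
        using avoids_onD[OF av C(1), of y p q] avoids_onD[OF av B(1), of p y b] C y(1) b(1) yb
        by (metis DiffD1 linorder_neqE)
    qed
    have single: "C = {x}" if "C \<in> Q" "C \<noteq> B" "x \<in> C" for C x
      using that no_pair[of C]
      by (metis empty_iff insertE insertI1 linorder_neqE subsetI subset_antisym)
    have "Q = one_block A B"
    proof (intro equalityI subsetI)
      fix C assume C: "C \<in> Q"
      then obtain x where x: "x \<in> C" using Q(2) by fastforce
      show "C \<in> one_block A B"
      proof (cases "C = B")
        case False
        then have "x \<in> A - B" using x C B(1) Q by blast
        then show ?thesis using single[OF C False x] by (auto simp: one_block_def)
      qed (simp add: one_block_def)
    next
      fix C assume "C \<in> one_block A B"
      then consider "C = B" | x where "C = {x}" "x \<in> A" "x \<notin> B"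
        by (auto simp: one_block_def)
      then show "C \<in> Q"
      proof cases
        case 2
        then obtain D where "D \<in> Q" "x \<in> D" using Q(1) by blast
        then show ?thesis using single 2 by blast
      qed (simp add: B)
    qed
    moreover have "(y, b) \<in> less_pairs A"
      using yb y(1) b(1) BA by (auto simp: less_pairs_def)
    ultimately show ?thesis using Beq by blast
  qed
next
  fix Q assume "Q \<in> ?R"
  then consider "Q = (\<lambda>x. {x}) ` A"
    | y b where "y \<in> A" "b \<in> A" "y < b" "Q = one_block A (pair_block A (y, b))"
    by (auto simp: less_pairs_def)
  then show "Q \<in> ?L"
  proof cases
    case 1
    then show ?thesis
      using partition_on_singletons by (auto simp: avoids_on_def)
  next
    case 2
    have "partition_on A Q"
      unfolding 2(4) using 2(1,2) by (intro partition_on_one_block) (auto simp: pair_block_def)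
    \<comment> \<open>Of two elements of the large block the smaller is at most \<open>y\<close>, so
      everything in \<open>A\<close> below it lies in that block too.\<close>
    moreover have "avoids_on A Q"
      unfolding 2(4) avoids_on_def using 2(3) by (auto simp: one_block_def pair_block_def)
    ultimately show ?thesis by blast
  qed
qed

text \<open>The pair is recovered from the block: \<open>b\<close> is its largest and
  \<open>y\<close> its second largest element.\<close>

lemma pair_block_inj:
  assumes "p \<in> less_pairs A" "q \<in> less_pairs A" "pair_block A p = pair_block A q"
  shows "p = q"
proof -
  obtain y b y' b' where pq: "p = (y, b)" "q = (y', b')" by fastforce
  have h: "y \<in> A" "b \<in> A" "y < b" "y' \<in> A" "b' \<in> A" "y' < b'"
    using assms(1,2) by (auto simp: pq less_pairs_def)
  have eq: "\<And>x. x = b \<or> x \<in> A \<and> x \<le> y \<longleftrightarrow> x = b' \<or> x \<in> A \<and> x \<le> y'"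
    using assms(3) by (auto simp: pq pair_block_def set_eq_iff)
  have "b = b'"
    using eq[of b] eq[of b'] h by force
  moreover from this have "y = y'"
    using eq[of y] eq[of y'] h by force
  ultimately show ?thesis by (simp add: pq)
qed

text \<open>This tells the large block from the singletons, so a partition determines its large
  block and is then not the discrete one.\<close>

lemma pair_block_not_singleton:
  assumes "p \<in> less_pairs A"
  shows "pair_block A p \<noteq> {x}"
proof -
  obtain y b where p: "p = (y, b)" by fastforce
  then have "y \<in> pair_block A p" "b \<in> pair_block A p" "y < b"
    using assms by (auto simp: less_pairs_def pair_block_def)
  then show ?thesis by auto
qed

text \<open>The elements of \<open>A\<close> above \<open>y\<close> other than \<open>b\<close> form
  the singleton blocks, and the large block makes up for \<open>b\<close>.\<close>

lemma card_one_block_pair_block: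
  assumes "finite A" "y \<in> A" "b \<in> A" "y < b"
  shows "card (one_block A (pair_block A (y, b))) = card {x\<in>A. y < x}"
proof -
  let ?B = "pair_block A (y, b)"
  have "?B \<notin> (\<lambda>x. {x}) ` (A - ?B)"
    using pair_block_not_singleton[of "(y, b)" A] assms by (auto simp: less_pairs_def)
  then have "card (one_block A ?B) = Suc (card (A - ?B))"
    using assms(1) by (simp add: one_block_def card_image)
  also have "A - ?B = {x\<in>A. y < x} - {b}"
    by (auto simp: pair_block_def)
  also have "Suc (card \<dots>) = card {x\<in>A. y < x}"
    using assms by (intro card_Suc_Diff1) auto
  finally show ?thesis .
qed

text \<open>As \<open>y\<close> runs through \<open>A\<close>, the number of elements above it takes
  each value below \<open>card A\<close> once. In the induction a new minimum has the whole old set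
  above it and changes no other count.\<close>

lemma sum_card_greater:
  fixes A :: "'a::linorder set" and h :: "nat \<Rightarrow> nat"
  assumes "finite A"
  shows "(\<Sum>y\<in>A. h (card {x\<in>A. y < x})) = (\<Sum>k<card A. h k)"
  using assms
proof (induction rule: finite_linorder_min_induct)
  case (insert m A)
  have "{x \<in> insert m A. m < x} = A"
    using insert by auto
  moreover have "{x \<in> insert m A. y < x} = {x\<in>A. y < x}" if "y \<in> A" for y
    using insert that by force
  moreover have "m \<notin> A" using insert by auto
  ultimately show ?case using insert by simp
qed simp

text \<open>If \<open>k\<close> elements lie above \<open>y\<close>, there are \<open>k\<close>
  choices of \<open>b\<close>, each giving a partition with \<open>k\<close> blocks; hence
  \<open>k * g k\<close>. The term \<open>g (card A)\<close> belongs to the discrete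
  partition.\<close>

lemma sum_avoiding_partitions:
  fixes A :: "'a::linorder set" and g :: "nat \<Rightarrow> nat"
  assumes "finite A"
  shows "(\<Sum>Q | partition_on A Q \<and> avoids_on A Q. g (card Q)) = g (card A) + (\<Sum>k<card A. k * g k)"
proof -
  let ?f = "\<lambda>p. one_block A (pair_block A p)"
  have fin: "finite (less_pairs A)"
    using assms by (simp add: less_pairs_def)
  have notin: "(\<lambda>x. {x}) ` A \<notin> ?f ` less_pairs A"
  proof
    assume "(\<lambda>x. {x}) ` A \<in> ?f ` less_pairs A"
    then obtain p where p: "p \<in> less_pairs A" "(\<lambda>x. {x}) ` A = ?f p" by blast
    then have "pair_block A p \<in> (\<lambda>x. {x}) ` A" by (simp add: one_block_def)
    then show False using pair_block_not_singleton[OF p(1)] by blast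
  qed
  have inj: "inj_on ?f (less_pairs A)"
  proof (rule inj_onI)
    fix p q assume pq: "p \<in> less_pairs A" "q \<in> less_pairs A" "?f p = ?f q"
    then have "pair_block A p = pair_block A q"
      using pair_block_not_singleton[OF pq(1)] by (auto simp: one_block_def)
    then show "p = q" using pair_block_inj pq by blast
  qed
  have "(\<Sum>Q | partition_on A Q \<and> avoids_on A Q. g (card Q))
      = g (card ((\<lambda>x. {x}) ` A)) + (\<Sum>p\<in>less_pairs A. g (card (?f p)))"
    unfolding avoiding_partitions_eq[OF assms] using fin notin by (simp add: sum.reindex[OF inj])
  also have "card ((\<lambda>x. {x}) ` A) = card A"
    by (simp add: card_image)
  also have "(\<Sum>p\<in>less_pairs A. g (card (?f p))) = (\<Sum>(y, b)\<in>less_pairs A. g (card {x\<in>A. y < x}))"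
    using assms by (intro sum.cong) (auto simp: less_pairs_def card_one_block_pair_block)
  also have "\<dots> = (\<Sum>y\<in>A. \<Sum>b\<in>{b\<in>A. y < b}. g (card {x\<in>A. y < x}))"
    unfolding less_pairs_def using assms by (subst sum.Sigma) auto
  also have "\<dots> = (\<Sum>k<card A. k * g k)"
    using sum_card_greater[OF assms, of "\<lambda>k. k * g k"] by simp
  finally show ?thesis .
qed

text \<open>Avoidance is decided by the restriction to \<open>A\<close>, so the partitions counted
  split into the classes \<open>exts S A Q\<close> for avoiding \<open>Q\<close>.\<close>

lemma card_partitions_avoids_on:
  fixes A S :: "'a::linorder set"
  assumes "finite S" "A \<subseteq> S"
  shows "card {P. partition_on S P \<and> avoids_on A P} =
    ext_num (card S - card A) (card A) + (\<Sum>k<card A. k * ext_num (card S - card A) k)"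
proof -
  let ?Q = "{Q. partition_on A Q \<and> avoids_on A Q}"
  have finA: "finite A" using assms finite_subset by blast
  have "{P. partition_on S P \<and> avoids_on A P} = (\<Union>Q\<in>?Q. exts S A Q)"
    using partition_on_restr[OF _ assms(2)] avoids_on_restr[of A] by (auto simp: exts_def)
  also have "card \<dots> = (\<Sum>Q\<in>?Q. card (exts S A Q))"
  proof (rule card_UN_disjoint)
    show "finite ?Q"
      by (rule finite_subset[OF _ finitely_many_partition_on[OF finA]]) auto
  qed (use assms(1) finite_exts in \<open>auto simp: exts_def\<close>)
  also have "\<dots> = (\<Sum>Q\<in>?Q. ext_num (card S - card A) (card Q))"
    using card_exts[OF assms] card_Diff_subset[OF finA assms(2)] by simp
  finally show ?thesis
    using sum_avoiding_partitions[OF finA] by simp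
qed

subsection \<open>Summing over the colour class\<close>

text \<open>Blocks cover \<open>{1..n}\<close> and are disjoint, so \<open>x \<notin> Y\<close>
  means that \<open>x\<close> lies in another block. Lying in blocks also keeps the three points
  inside \<open>{1..n}\<close>, so values of \<open>f\<close> elsewhere cannot create a
  pattern.\<close>

lemma avoids_on_iff_not_contains:
  assumes "partition_on {1..n} P"
  shows "\<not> eq_contains_122 a (P, f) \<longleftrightarrow> avoids_on {x\<in>{1..n}. f x = a} P"
proof -
  have P: "\<Union>P = {1..n}" "\<And>X Y x. X \<in> P \<Longrightarrow> Y \<in> P \<Longrightarrow> x \<in> X \<Longrightarrow> x \<in> Y \<Longrightarrow> X = Y"
    using assms by (auto simp: partition_on_def disjoint_def)
  let ?A = "{x\<in>{1..n}. f x = a}"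
  show ?thesis
  proof
    assume L: "\<not> eq_contains_122 a (P, f)"
    show "avoids_on ?A P"
      unfolding avoids_on_def
    proof (intro ballI impI, rule ccontr)
      fix x y z Y
      assume h: "x \<in> ?A" "y \<in> ?A" "z \<in> ?A" "Y \<in> P" "x < y" "y < z" "y \<in> Y" "z \<in> Y" "x \<notin> Y"
      then obtain X where "X \<in> P" "x \<in> X" using P(1) by blast
      moreover have "X \<noteq> Y" "f x = a" "f y = a" "f z = a" using h calculation by auto
      ultimately have "eq_contains_122 a (P, f)"
        unfolding eq_contains_122_def fst_conv snd_conv
        using h(4-8) by (intro exI[of _ x] exI[of _ y] exI[of _ z] conjI bexI[of _ X] bexI[of _ Y])
      then show False using L by blast
    qed
  next
    assume R: "avoids_on ?A P"
    show "\<not> eq_contains_122 a (P, f)"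
    proof
      assume "eq_contains_122 a (P, f)"
      then obtain x y z where "x < y \<and> y < z \<and> f x = a \<and> f y = a \<and> f z = a \<and>
          (\<exists>X\<in>P. \<exists>Y\<in>P. X \<noteq> Y \<and> x \<in> X \<and> y \<in> Y \<and> z \<in> Y)"
        unfolding eq_contains_122_def fst_conv snd_conv by (elim exE)
      then obtain X Y where h: "x < y" "y < z" "f x = a" "f y = a" "f z = a"
        "X \<in> P" "Y \<in> P" "X \<noteq> Y" "x \<in> X" "y \<in> Y" "z \<in> Y"
        by (elim conjE bexE)
      then have "x \<in> ?A" "y \<in> ?A" "z \<in> ?A" using P(1) by blast+
      then have "x \<in> Y" using avoids_onD[OF R, of Y x y z] h by blast
      then show False using P(2) h by blast
    qed
  qed
qed

text \<open>A prescribed class makes the choices at the points independent: only \<open>a\<close> on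
  \<open>A\<close>, any other colour off \<open>A\<close>.\<close>

lemma card_colorings_with_class:
  assumes "finite S" "A \<subseteq> S" "finite C" "a \<in> C"
  shows "card {f \<in> S \<rightarrow>\<^sub>E C. {x\<in>S. f x = a} = A} = (card C - 1) ^ (card S - card A)"
proof -
  have "{f \<in> S \<rightarrow>\<^sub>E C. {x\<in>S. f x = a} = A} = (\<Pi>\<^sub>E x\<in>S. if x \<in> A then {a} else C - {a})"
    using assms(2,4) by (auto simp: PiE_iff extensional_def split: if_splits)
  also have "card \<dots> = (\<Prod>x\<in>S. if x \<in> A then 1 else card C - 1)"
    using assms by (subst card_PiE) (auto intro!: prod.cong)
  also have "\<dots> = (card C - 1) ^ card (S - A)"
    using assms by (simp add: prod.If_cases Diff_eq)
  finally show ?thesis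
    using assms by (simp add: card_Diff_subset finite_subset)
qed

lemma sum_Pow_card:
  fixes h :: "nat \<Rightarrow> nat"
  assumes "finite S"
  shows "(\<Sum>A\<in>Pow S. h (card A)) = (\<Sum>i = 0..card S. (card S choose i) * h i)"
proof -
  have "(\<Sum>A\<in>Pow S. h (card A)) = (\<Sum>i = 0..card S. \<Sum>A | A \<in> Pow S \<and> card A = i. h (card A))"
    using assms by (intro sum.group[symmetric]) (auto intro: card_mono)
  also have "\<dots> = (\<Sum>i = 0..card S. (card S choose i) * h i)"
    using assms by (intro sum.cong) (auto simp: n_subsets)
  finally show ?thesis .
qed

text \<open>Once the class \<open>A\<close> of colour \<open>a\<close> is fixed, avoidance concerns
  the partition alone. The avoiders with this class therefore form a product \<open>F A\<close>,
  whose size depends only on \<open>card A\<close>.\<close>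

lemma card_eq_avoiders:
  assumes "a \<in> {1..c}"
  shows "card (eq_avoiders_122 n c a) = (\<Sum>i = 0..n. (n choose i) *
    ((ext_num (n - i) i + (\<Sum>k<i. k * ext_num (n - i) k)) * (c - 1) ^ (n - i)))"
proof -
  define F where "F A = {P. partition_on {1..n} P \<and> avoids_on A P} \<times>
    {f \<in> {1..n} \<rightarrow>\<^sub>E {1..c}. {x\<in>{1..n}. f x = a} = A}" for A
  have "eq_avoiders_122 n c a = (\<Union>A\<in>Pow {1..n}. F A)"
    using avoids_on_iff_not_contains
    by (force simp: eq_avoiders_122_def colored_partitions_def F_def)
  also have "card \<dots> = (\<Sum>A\<in>Pow {1..n}. card (F A))"
  proof (rule card_UN_disjoint)
    have "finite (F A)" for A
      unfolding F_def
      by (intro finite_cartesian_product finite_subset[OF _ finitely_many_partition_on[of "{1..n}"]]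
          finite_subset[OF _ finite_PiE[of "{1..n}" "\<lambda>_. {1..c}"]]) auto
    then show "\<forall>A\<in>Pow {1..n}. finite (F A)" by blast
    show "\<forall>A\<in>Pow {1..n}. \<forall>B\<in>Pow {1..n}. A \<noteq> B \<longrightarrow> F A \<inter> F B = {}"
      unfolding F_def by blast
  qed simp
  also have "\<dots> = (\<Sum>A\<in>Pow {1..n}. (ext_num (n - card A) (card A) +
      (\<Sum>k<card A. k * ext_num (n - card A) k)) * (c - 1) ^ (n - card A))"
  proof (rule sum.cong)
    fix A assume "A \<in> Pow {1..n}"
    then have A: "A \<subseteq> {1..n}" by simp
    show "card (F A) = (ext_num (n - card A) (card A) +
      (\<Sum>k<card A. k * ext_num (n - card A) k)) * (c - 1) ^ (n - card A)"
      unfolding F_def card_cartesian_product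
      using card_partitions_avoids_on[OF _ A] card_colorings_with_class[OF _ A _ assms] by simp
  qed simp
  also have "\<dots> = (\<Sum>i = 0..n. (n choose i) *
      ((ext_num (n - i) i + (\<Sum>k<i. k * ext_num (n - i) k)) * (c - 1) ^ (n - i)))"
    using sum_Pow_card[of "{1..n}" "\<lambda>i. (ext_num (n - i) i +
      (\<Sum>k<i. k * ext_num (n - i) k)) * (c - 1) ^ (n - i)"] by simp
  finally show ?thesis .
qed

text \<open>For \<open>k \<ge> 1\<close> write \<open>k * g k = g k + (k - 1) * g k\<close>. The
  parts \<open>g k\<close> together with \<open>g i\<close> form the first sum via
  \<open>k = i - l + 1\<close>; the rest forms the second via \<open>k = i - l\<close>.\<close>

lemma sum_avoiding_reindex:
  fixes g :: "nat \<Rightarrow> nat"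
  assumes "i \<ge> 1"
  shows "g i + (\<Sum>k<i. k * g k) =
    (\<Sum>l = 1..i. g (i - l + 1)) + (\<Sum>l = 1..i - 2. (i - l - 1) * g (i - l))"
proof -
  have 1: "(\<Sum>l = 1..i. g (i - l + 1)) = (\<Sum>k = 1..i. g k)"
    by (rule sum.reindex_bij_witness[of _ "\<lambda>k. i - k + 1" "\<lambda>l. i - l + 1"])
      (simp_all only: atLeastAtMost_iff, linarith+)
  have "(\<Sum>l = 1..i - 2. (i - l - 1) * g (i - l)) = (\<Sum>k = 2..i - 1. (k - 1) * g k)"
    by (rule sum.reindex_bij_witness[of _ "\<lambda>k. i - k" "\<lambda>l. i - l"])
      (simp_all only: atLeastAtMost_iff, linarith+)
  \<comment> \<open>Only terms with \<open>k = 1\<close> can be new here, and the factor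
    \<open>k - 1\<close> makes them zero.\<close>
  also have "\<dots> = (\<Sum>k = 1..<i. (k - 1) * g k)"
    by (rule sum.mono_neutral_left) auto
  finally have 2: "(\<Sum>l = 1..i - 2. (i - l - 1) * g (i - l)) = (\<Sum>k = 1..<i. (k - 1) * g k)" .
  have "(\<Sum>k<i. k * g k) = (\<Sum>k = 1..<i. k * g k)"
    by (rule sum.mono_neutral_right) auto
  also have "\<dots> = (\<Sum>k = 1..<i. g k + (k - 1) * g k)"
  proof (rule sum.cong)
    show "k * g k = g k + (k - 1) * g k" if "k \<in> {1..<i}" for k
      using that by (cases k) simp_all
  qed simp
  also have "\<dots> = (\<Sum>k = 1..<i. g k) + (\<Sum>k = 1..<i. (k - 1) * g k)"
    by (rule sum.distrib)
  finally have 3: "(\<Sum>k<i. k * g k) = (\<Sum>k = 1..<i. g k) + (\<Sum>k = 1..<i. (k - 1) * g k)" .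
  have "{1..i} = insert i {1..<i}" using assms by auto
  then have 4: "(\<Sum>k = 1..i. g k) = g i + (\<Sum>k = 1..<i. g k)" by (simp only:) simp
  show ?thesis unfolding 1 2 3 4 by (simp only: add.assoc)
qed

theorem theorem5p5:
  fixes n c a :: nat
  assumes "n \<ge> 1" and "c \<ge> 1" and "a \<in> {1..c}"
  shows "card (eq_avoiders_122 n c a) =
      bell n * (c - 1) ^ n + bell n * n * (c - 1) ^ (n - 1)
    + (\<Sum>i = 2..n. \<Sum>l = 1..i. \<Sum>j = 0..n - i.
        (n choose i) * ((n - i) choose j) * (i - l + 1) ^ j * bell (n - i - j) * (c - 1) ^ (n - i))
    + (\<Sum>i = 2..n. \<Sum>l = 1..i - 2. \<Sum>j = 0..n - i.
        (n choose i) * ((n - i) choose j) * (i - l - 1) * (i - l) ^ j * bell (n - i - j) * (c - 1) ^ (n - i))"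
proof -
  \<comment> \<open>\<open>T i\<close> counts the avoiders with exactly \<open>i\<close> elements of
    colour \<open>a\<close>. The stated sums start at \<open>i = 2\<close>; \<open>T 0\<close> and
    \<open>T 1\<close> are the two terms before them.\<close>
  define T where "T i = (n choose i) *
    ((ext_num (n - i) i + (\<Sum>k<i. k * ext_num (n - i) k)) * (c - 1) ^ (n - i))" for i
  have T0: "T 0 = bell n * (c - 1) ^ n"
    by (simp add: T_def bell_eq_ext_num)
  \<comment> \<open>Every partition of \<open>n \<ge> 1\<close> points extends the only partition of
    one point.\<close>
  have "ext_num (n - 1) 1 = bell n"
    using assms(1) by (cases n) (auto simp: bell_eq_ext_num)
  then have T1: "T 1 = bell n * n * (c - 1) ^ (n - 1)"
    by (simp add: T_def)
  have T2: "T i =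
      (\<Sum>l = 1..i. \<Sum>j = 0..n - i. (n choose i) * ((n - i) choose j) * (i - l + 1) ^ j
        * bell (n - i - j) * (c - 1) ^ (n - i))
    + (\<Sum>l = 1..i - 2. \<Sum>j = 0..n - i. (n choose i) * ((n - i) choose j) * (i - l - 1)
        * (i - l) ^ j * bell (n - i - j) * (c - 1) ^ (n - i))"
    if "i \<in> {2..n}" for i
  proof -
    have "i \<ge> 1" using that by simp
    show ?thesis
      \<comment> \<open>The function \<open>g\<close> is \<open>ext_num (n - i)\<close>; expanding
        its values at \<open>i - l + 1\<close> and \<open>i - l\<close> in Bell numbers produces the
        sums over \<open>j\<close>.\<close>
      unfolding T_def sum_avoiding_reindex[OF \<open>i \<ge> 1\<close>, of "ext_num (n - i)"]
      unfolding ext_num_eq_sum_bell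
      by (simp only: sum_distrib_left sum_distrib_right distrib_left distrib_right mult_ac)
  qed
  have "sum T {0..n} = sum T (insert 0 (insert 1 {2..n}))"
    using assms(1) by (intro arg_cong[of _ _ "sum T"]) auto
  also have "\<dots> = T 0 + T 1 + sum T {2..n}"
    by (simp add: add.assoc)
  also have "sum T {2..n} = (\<Sum>i = 2..n.
      (\<Sum>l = 1..i. \<Sum>j = 0..n - i. (n choose i) * ((n - i) choose j) * (i - l + 1) ^ j
        * bell (n - i - j) * (c - 1) ^ (n - i))
    + (\<Sum>l = 1..i - 2. \<Sum>j = 0..n - i. (n choose i) * ((n - i) choose j) * (i - l - 1)
        * (i - l) ^ j * bell (n - i - j) * (c - 1) ^ (n - i)))"
    by (intro sum.cong refl T2)
  finally show ?thesis
    unfolding card_eq_avoiders[OF assms(3)] T_def[symmetric] T0 T1 sum.distrib add.assoc .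
qed

end
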